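(* Let $\sigma$ be a (finite, positive) measure on $\mathbb{T}^3$ such that, for some $\beta>2/3$, $|\widehat\sigma(\xi)|\lesssim(1+|\xi|)^{-\beta}$ for all $\xi\in\mathbb{Z}^3$. Then for every integer $N\ge1$ and every complex sequence $a=(a_n)_{1\le n\le N}$, $$\int_{\mathbb{T}^3}\Big|\sum_{n=1}^Na_n\,e(x_1n+x_2n^2+x_3n^3)\Big|^4d\sigma(x)\lesssim\|a\|_{\ell^2}^4,$$ with the implicit constant independent of $N$ (and of $a$).
   Context: $e(t)=e^{2\pi it}$; $\widehat\sigma(\xi)=\int_{\mathbb{T}^3}e(-\xi\cdot x)\,d\sigma(x)$; $\|a\|_{\ell^2}=(\sum_{n=1}^N|a_n|^2)^{1/2}$. The implicit constant may depend on $\sigma$ and $\beta$. *)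

theory Defs
  imports "HOL-Analysis.Analysis"
begin

definition e :: "real \<Rightarrow> complex"
  where "e t = exp (2 * of_real pi * \<i> * of_real t)"

text \<open>
  The torus \<open>\<real>\<^sup>3/\<int>\<^sup>3\<close> is represented by the fundamental domain \<open>[0,1)\<^sup>3\<close>. The quotient map restricted
  to this domain is a Borel isomorphism onto the torus, so Borel measures on the torus are exactly
  measures on the Borel sets of the domain; all integrands below are \<open>\<int>\<^sup>3\<close>-periodic.
\<close>

definition torus3 :: "(real ^ 3) set"
  where "torus3 = {x. \<forall>i. 0 \<le> x $ i \<and> x $ i < 1}"

definition torus3_measure :: "(real ^ 3) measure \<Rightarrow> bool"
  where "torus3_measure \<sigma> \<longleftrightarrow>
    sets \<sigma> = sets (restrict_space borel torus3) \<and> finite_measure \<sigma>"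

definition real_vec :: "int ^ 3 \<Rightarrow> real ^ 3"
  where "real_vec \<xi> = (\<chi> i. real_of_int (\<xi> $ i))"

definition fourier_coeff :: "(real ^ 3) measure \<Rightarrow> int ^ 3 \<Rightarrow> complex"
  where "fourier_coeff \<sigma> \<xi> = (\<integral>x. e (- (real_vec \<xi> \<bullet> x)) \<partial>\<sigma>)"

definition l2_norm :: "nat \<Rightarrow> (nat \<Rightarrow> complex) \<Rightarrow> real"
  where "l2_norm N a = sqrt (\<Sum>n=1..N. (cmod (a n))\<^sup>2)"

end

theory Submission
  imports Defs
begin

text \<open>
  Writing the fourth power as \<open>|S\<^sup>2|\<^sup>2\<close> and expanding, the integral is a quadratic form in the products
  \<open>a\<^sub>m a\<^sub>n\<close> with kernel given by Fourier coefficients of \<open>\<sigma>\<close>, so by Schur's test it is enough to bound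
  \<open>\<Sum>\<^sub>p (1 + |\<Phi>\<^sub>p - \<Phi>\<^sub>q|)\<^sup>-\<^sup>\<beta>\<close> uniformly in \<open>q\<close>, where \<open>\<Phi>\<^sub>p = (x + y, x\<^sup>2 + y\<^sup>2, x\<^sup>3 + y\<^sup>3)\<close> for \<open>p = (x, y)\<close>.
  For \<open>\<beta> > 2/3\<close> this follows by dyadic summation over \<open>H = 8\<^sup>k\<close> once the number of \<open>p\<close> with \<open>|\<Phi>\<^sub>p - \<Phi>\<^sub>q| \<le> H\<close>
  is \<open>O(H\<^sup>2\<^sup>/\<^sup>3)\<close>. With \<open>T = H\<^sup>1\<^sup>/\<^sup>3\<close> and \<open>x \<le> y\<close>: if \<open>x \<le> T\<^sup>2\<close>, the cubes alone leave \<open>O(T)\<close> values of \<open>y\<close>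
  for \<open>x \<le> T\<close> and \<open>O(1 + H/x\<^sup>2)\<close> otherwise; if \<open>x > T\<^sup>2\<close> and \<open>y - x \<le> T\<close>, the squares leave \<open>O(T)\<close> values
  of \<open>x\<close> for each \<open>y - x\<close>; if \<open>x > T\<^sup>2\<close> and \<open>y - x > T\<close>, then \<open>x\<close> determines \<open>y\<close> through the cubes, and
  squares and cubes together confine \<open>x\<close> to an interval of length \<open>O(T\<^sup>2)\<close>.
\<close>

section \<open>Cardinality bounds for sets of integers and for fibred sets\<close>

lemma card_int_le_diameter:
  fixes A :: "int set"
  assumes "D \<ge> 0" and "\<And>a b. a \<in> A \<Longrightarrow> b \<in> A \<Longrightarrow> real_of_int \<bar>a - b\<bar> \<le> D"
  shows "real (card A) \<le> D + 1"
proof (cases "A = {}")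
  case False
  then obtain c where c: "c \<in> A" by blast
  have "\<bar>a - c\<bar> \<le> \<lfloor>D\<rfloor>" if "a \<in> A" for a
    using assms(2)[OF that c] by (simp add: le_floor_iff)
  \<comment> \<open>This crude interval only yields finiteness, hence a minimum; measuring from the
    minimum then gives \<open>D + 1\<close> instead of \<open>2 * D + 1\<close>.\<close>
  then have "A \<subseteq> {c - \<lfloor>D\<rfloor>..c + \<lfloor>D\<rfloor>}" by fastforce
  then have fin: "finite A" by (rule finite_subset) simp
  define m where "m = Min A"
  have m: "m \<in> A" unfolding m_def using fin False by simp
  have "A \<subseteq> {m..m + \<lfloor>D\<rfloor>}"
  proof
    fix a assume a: "a \<in> A"
    have "m \<le> a" unfolding m_def using fin a by simp
    moreover have "\<bar>a - m\<bar> \<le> \<lfloor>D\<rfloor>" using assms(2)[OF a m] by (simp add: le_floor_iff)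
    ultimately show "a \<in> {m..m + \<lfloor>D\<rfloor>}" by auto
  qed
  then have "card A \<le> card {m..m + \<lfloor>D\<rfloor>}" by (intro card_mono) auto
  also have "\<dots> = nat (\<lfloor>D\<rfloor> + 1)" by simp
  finally have "real (card A) \<le> real (nat (\<lfloor>D\<rfloor> + 1))" by simp
  also have "\<dots> = of_int \<lfloor>D\<rfloor> + 1" using \<open>D \<ge> 0\<close> by simp
  also have "\<dots> \<le> D + 1" by simp
  finally show ?thesis .
qed (use assms in simp)

lemma card_le_sum_fibres:
  fixes g :: "'a \<Rightarrow> real"
  assumes "finite F" "finite B" "fst ` F \<subseteq> B"
    and "\<And>x. x \<in> B \<Longrightarrow> real (card {y. (x, y) \<in> F}) \<le> g x"
  shows "real (card F) \<le> (\<Sum>x\<in>B. g x)"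
proof -
  have fib: "finite {y. (x, y) \<in> F}" for x
    by (rule finite_subset[of _ "snd ` F"]) (use assms(1) in force)+
  have "F = Sigma B (\<lambda>x. {y. (x, y) \<in> F})"
    using assms(3) by force
  then have "card F = (\<Sum>x\<in>B. card {y. (x, y) \<in> F})"
    using card_SigmaI[OF assms(2), of "\<lambda>x. {y. (x, y) \<in> F}"] fib by metis
  then show ?thesis
    using assms(4) by (simp add: sum_mono)
qed

section \<open>Separation of cubes and of sums of two powers\<close>

lemma cube_diff_ge:
  fixes m y z :: int
  assumes "0 \<le> m" "m \<le> y" "m \<le> z"
  shows "3 * m\<^sup>2 * \<bar>y - z\<bar> \<le> \<bar>y ^ 3 - z ^ 3\<bar>"
proof -
  have "m\<^sup>2 \<le> y\<^sup>2" "m\<^sup>2 \<le> z\<^sup>2" "m * m \<le> y * z"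
    using assms by (auto intro: power_mono mult_mono)
  then have "3 * m\<^sup>2 \<le> y\<^sup>2 + y * z + z\<^sup>2" by (simp add: power2_eq_square)
  then have "3 * m\<^sup>2 * \<bar>y - z\<bar> \<le> \<bar>y\<^sup>2 + y * z + z\<^sup>2\<bar> * \<bar>y - z\<bar>"
    by (intro mult_right_mono) auto
  also have "\<dots> = \<bar>(y\<^sup>2 + y * z + z\<^sup>2) * (y - z)\<bar>" by (simp add: abs_mult)
  also have "(y\<^sup>2 + y * z + z\<^sup>2) * (y - z) = y ^ 3 - z ^ 3"
    by (simp add: power2_eq_square power3_eq_cube algebra_simps)
  finally show ?thesis .
qed

text \<open>For v <= w the excess of w^3 - v^3 over (w - v)^3 is 3wv(w - v). This bound serves where
  no good lower bound on y and z is at hand, so that \<open>cube_diff_ge\<close> would be too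
  weak.\<close>

lemma cube_diff_ge_diff_cube:
  fixes y z :: int
  assumes "0 \<le> y" "0 \<le> z"
  shows "\<bar>y - z\<bar> ^ 3 \<le> \<bar>y ^ 3 - z ^ 3\<bar>"
proof -
  have *: "(w - v) ^ 3 \<le> w ^ 3 - v ^ 3" if "0 \<le> v" "v \<le> w" for v w :: int
  proof -
    have "w ^ 3 - v ^ 3 - (w - v) ^ 3 = 3 * w * v * (w - v)"
      by (simp add: power3_eq_cube algebra_simps)
    moreover have "0 \<le> 3 * w * v * (w - v)" using that by simp
    ultimately show ?thesis by linarith
  qed
  show ?thesis
  proof (cases "y \<le> z")
    case True
    then show ?thesis using *[of y z] assms by (simp add: abs_minus_commute[of y] abs_minus_commute[of "y ^ 3"])
  next
    case False
    then show ?thesis using *[of z y] assms by simp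
  qed
qed

text \<open>Telescoping, since 1/(M + 1)^2 <= 1/M - 1/(M + 1). Multiplied by T^3, the resulting tail
  bound 1/T is of the admissible size T^2.\<close>

lemma sum_inverse_squares_le:
  fixes T M :: int
  assumes "1 \<le> T" "T \<le> M"
  shows "(\<Sum>x\<in>{T<..M}. 1 / (real_of_int x)\<^sup>2) \<le> 1 / T - 1 / M"
  using assms(2)
proof (induction M rule: int_ge_induct)
  case (step M)
  have "{T<..M + 1} = insert (M + 1) {T<..M}" using step by auto
  then have "(\<Sum>x\<in>{T<..M + 1}. 1 / (real_of_int x)\<^sup>2)
      = 1 / (real_of_int (M + 1))\<^sup>2 + (\<Sum>x\<in>{T<..M}. 1 / (real_of_int x)\<^sup>2)" by simp
  also have "1 / (real_of_int (M + 1))\<^sup>2 \<le> 1 / M - 1 / (M + 1)"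
  proof -
    have "1 / (real_of_int (M + 1))\<^sup>2 \<le> 1 / (real_of_int M * real_of_int (M + 1))"
      using step assms(1) by (intro frac_le) (auto simp: power2_eq_square)
    also have "\<dots> = 1 / M - 1 / (M + 1)"
      using step assms(1) by (simp add: field_simps)
    finally show ?thesis .
  qed
  finally show ?case using step by simp
qed simp

text \<open>Eliminating the second increment from the two window conditions isolates the first one,
  with a determinant that is a positive combination once both pairs are \<open>T\<close>-separated from the diagonal.\<close>

lemma first_increment_le:
  fixes x y x' y' T :: int
  assumes T: "1 \<le> T" and x: "T \<le> x" "x + T \<le> y" and x': "T \<le> x'" "x' + T \<le> y'"
    and sq: "\<bar>(x'\<^sup>2 + y'\<^sup>2) - (x\<^sup>2 + y\<^sup>2)\<bar> \<le> 2 * T ^ 3"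
    and cube: "\<bar>(x' ^ 3 + y' ^ 3) - (x ^ 3 + y ^ 3)\<bar> \<le> 2 * T ^ 3"
  shows "\<bar>x' - x\<bar> \<le> 11 * T\<^sup>2"
proof -
  define d where "d = y - x"
  define d' where "d' = y' - x'"
  \<comment> \<open>The difference of the sums of squares is u(x' - x) + v(y' - y), that of the sums
    of cubes is a(x' - x) + b(y' - y); \<open>c\<close> is the analogue of \<open>a\<close> for the
    gaps \<open>d\<close>, \<open>d'\<close>.\<close>
  define u where "u = x + x'"
  define v where "v = y + y'"
  define a where "a = x\<^sup>2 + x * x' + x'\<^sup>2"
  define b where "b = y\<^sup>2 + y * y' + y'\<^sup>2"
  define c where "c = d\<^sup>2 + d * d' + d'\<^sup>2"
  have d: "T \<le> d" "T \<le> d'" using x x' by (auto simp: d_def d'_def)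
  have y: "y = x + d" "y' = x' + d'" by (auto simp: d_def d'_def)
  have pos: "0 \<le> x" "0 \<le> x'" "0 \<le> y" "0 \<le> y'" "1 \<le> y" "1 \<le> y'" using T x x' by auto
  have c0: "0 \<le> c" and v1: "1 \<le> v"
    using pos d T by (auto simp: c_def v_def intro!: add_nonneg_nonneg)
  have vb: "v \<le> b"
  proof -
    have "y \<le> y\<^sup>2" "y' \<le> y'\<^sup>2" "0 \<le> y * y'" using pos by (auto simp: power2_eq_square)
    then show ?thesis by (simp add: v_def b_def)
  qed
  have b1: "1 \<le> b" using vb v1 by simp
  \<comment> \<open>In terms of x, x', d, d' the determinant is a sum of nonnegative products, each
    with a factor d, d' or u, and all three are at least T.\<close>
  have det: "T * (a + c) \<le> u * b - a * v"
  proof -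
    have "T * (a + c) \<le> T * (a + c) + 3 * T * (x * x')" using T pos by simp
    also have "\<dots> = T * (x\<^sup>2 + 2 * x * x') + T * (x'\<^sup>2 + 2 * x * x') + T * c"
      by (simp add: a_def algebra_simps)
    also have "\<dots> \<le> d * (x\<^sup>2 + 2 * x * x') + d' * (x'\<^sup>2 + 2 * x * x') + u * c"
      using d pos x c0 by (intro add_mono mult_right_mono) (auto simp: u_def)
    also have "\<dots> = u * b - a * v"
      by (simp add: u_def b_def a_def v_def c_def y power2_eq_square algebra_simps)
    finally show ?thesis .
  qed
  \<comment> \<open>Since y = x + d and y' = x' + d', \<open>b\<close> is controlled by
    \<open>a + c\<close>, here through an explicit sum of squares. The determinant is thus at least
    3Tb/8.\<close>
  have bc: "3 * b \<le> 8 * (a + c)"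
  proof -
    have "8 * (a + c) - 3 * b = 2 * (x - x')\<^sup>2 + 2 * (d - d')\<^sup>2 + 3 * (u - (d + d'))\<^sup>2 + 3 * (y * y')"
      by (simp add: a_def b_def c_def u_def y power2_eq_square algebra_simps)
    also have "\<dots> \<ge> 0" using pos by (intro add_nonneg_nonneg) auto
    finally show ?thesis by simp
  qed
  have "(x' - x) * (u * b - a * v)
      = ((x'\<^sup>2 + y'\<^sup>2) - (x\<^sup>2 + y\<^sup>2)) * b - ((x' ^ 3 + y' ^ 3) - (x ^ 3 + y ^ 3)) * v"
    by (simp add: u_def b_def a_def v_def power2_eq_square power3_eq_cube algebra_simps)
  then have "\<bar>x' - x\<bar> * \<bar>u * b - a * v\<bar> \<le> \<bar>((x'\<^sup>2 + y'\<^sup>2) - (x\<^sup>2 + y\<^sup>2)) * b\<bar> + \<bar>((x' ^ 3 + y' ^ 3) - (x ^ 3 + y ^ 3)) * v\<bar>"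
    by (metis abs_mult abs_triangle_ineq4)
  also have "\<dots> \<le> 2 * T ^ 3 * b + 2 * T ^ 3 * b"
    unfolding abs_mult using sq cube vb v1 b1 T by (intro add_mono mult_mono) auto
  finally have *: "\<bar>x' - x\<bar> * \<bar>u * b - a * v\<bar> \<le> 4 * T ^ 3 * b" by linarith
  \<comment> \<open>Cancelling Tb leaves 3|x' - x| <= 32 T^2, and 11 is 32/3 rounded up.\<close>
  have "T * (3 * b) * \<bar>x' - x\<bar> \<le> T * (8 * (a + c)) * \<bar>x' - x\<bar>"
    using bc T by (intro mult_right_mono mult_left_mono) auto
  also have "\<dots> \<le> 8 * (\<bar>x' - x\<bar> * \<bar>u * b - a * v\<bar>)"
    using mult_right_mono[OF det, of "8 * \<bar>x' - x\<bar>"] mult_left_mono[OF abs_ge_self, of "8 * \<bar>x' - x\<bar>" "u * b - a * v"]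
    by (simp add: algebra_simps)
  also have "\<dots> \<le> 32 * T ^ 3 * b" using * by linarith
  finally have "(T * b) * (3 * \<bar>x' - x\<bar>) \<le> (T * b) * (32 * T\<^sup>2)"
    by (simp add: power2_eq_square power3_eq_cube algebra_simps)
  then have "3 * \<bar>x' - x\<bar> \<le> 32 * T\<^sup>2"
    using T b1 by (simp add: mult_le_cancel_left)
  also have "\<dots> \<le> 3 * (11 * T\<^sup>2)" by simp
  finally show ?thesis by simp
qed

section \<open>Counting pairs with nearly equal sums of squares and of cubes\<close>

text \<open>The windows are stated as diameters, so the centre q disappears: two points within T^3
  of q are within 2T^3 of each other. The four regions \<open>A\<close>, \<open>B\<close>,
  \<open>C\<close>, \<open>D\<close> contribute 3 + 2 + 3 + 12 = 20.\<close>

lemma card_ordered_pairs_le: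
  fixes F :: "(int \<times> int) set" and T :: int
  assumes fin: "finite F" and T: "1 \<le> T"
    and pos: "\<And>x y. (x, y) \<in> F \<Longrightarrow> 1 \<le> x \<and> x \<le> y"
    and sq: "\<And>x y x' y'. (x, y) \<in> F \<Longrightarrow> (x', y') \<in> F \<Longrightarrow>
      \<bar>(x'\<^sup>2 + y'\<^sup>2) - (x\<^sup>2 + y\<^sup>2)\<bar> \<le> 2 * T ^ 3"
    and cube: "\<And>x y x' y'. (x, y) \<in> F \<Longrightarrow> (x', y') \<in> F \<Longrightarrow>
      \<bar>(x' ^ 3 + y' ^ 3) - (x ^ 3 + y ^ 3)\<bar> \<le> 2 * T ^ 3"
  shows "real (card F) \<le> 20 * (real_of_int T)\<^sup>2"
proof -
  define A where "A = {p \<in> F. fst p \<le> T}"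
  define B where "B = {p \<in> F. T < fst p \<and> fst p \<le> T\<^sup>2}"
  define C where "C = {p \<in> F. T\<^sup>2 < fst p \<and> snd p \<le> fst p + T}"
  define D where "D = {p \<in> F. T\<^sup>2 < fst p \<and> fst p + T < snd p}"
  have finite: "finite A" "finite B" "finite C" "finite D"
    using fin by (auto simp: A_def B_def C_def D_def)
  have TT: "T \<le> T\<^sup>2" using T by (simp add: power2_eq_square)
  have T1: "1 \<le> real_of_int T" using T by simp
  then have TTr: "real_of_int T \<le> (real_of_int T)\<^sup>2" "1 \<le> (real_of_int T)\<^sup>2"
    by (auto simp: self_le_power one_le_power)
  have fibre: "\<bar>y ^ 3 - z ^ 3\<bar> \<le> 2 * T ^ 3" if "(x, y) \<in> F" "(x, z) \<in> F" for x y z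
    using cube[OF that(2) that(1)] by simp

  have A: "real (card A) \<le> 3 * (real_of_int T)\<^sup>2"
  proof -
    have "real (card A) \<le> (\<Sum>x\<in>{1..T}. 2 * real_of_int T + 1)"
    proof (rule card_le_sum_fibres)
      show "fst ` A \<subseteq> {1..T}" using pos by (auto simp: A_def)
      fix x assume "x \<in> {1..T}"
      show "real (card {y. (x, y) \<in> A}) \<le> 2 * real_of_int T + 1"
      proof (rule card_int_le_diameter)
        fix y z assume "y \<in> {y. (x, y) \<in> A}" "z \<in> {y. (x, y) \<in> A}"
        then have yz: "(x, y) \<in> F" "(x, z) \<in> F" by (auto simp: A_def)
        have "\<bar>y - z\<bar> ^ 3 \<le> 2 * T ^ 3"
          using cube_diff_ge_diff_cube[of y z] fibre[OF yz] pos[OF yz(1)] pos[OF yz(2)] by simp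
        also have "\<dots> \<le> (2 * T) ^ 3" using T by (simp add: power_mult_distrib)
        finally have "\<bar>y - z\<bar> \<le> 2 * T" using T power_mono_iff[of "\<bar>y - z\<bar>" "2 * T" 3] by simp
        then show "real_of_int \<bar>y - z\<bar> \<le> 2 * real_of_int T" by linarith
      qed (use T in simp)
    qed (use finite in auto)
    also have "\<dots> = real_of_int T * (2 * real_of_int T + 1)" using T by simp
    also have "\<dots> \<le> 3 * (real_of_int T)\<^sup>2" using TTr by (simp add: power2_eq_square algebra_simps)
    finally show ?thesis .
  qed

  have B: "real (card B) \<le> 2 * (real_of_int T)\<^sup>2"
  proof -
    \<comment> \<open>The fibre over x has diameter at most 2T^3/(3x^2), which sums to at most
      2T^2/3 beyond T. The extra 1 per fibre costs at most T^2 in total because x stops at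
      T^2.\<close>
    have "real (card B) \<le> (\<Sum>x\<in>{T<..T\<^sup>2}. (2 * real_of_int T ^ 3 / 3) * (1 / (real_of_int x)\<^sup>2) + 1)"
    proof (rule card_le_sum_fibres)
      show "fst ` B \<subseteq> {T<..T\<^sup>2}" by (auto simp: B_def)
      fix x assume "x \<in> {T<..T\<^sup>2}"
      then have x: "T < x" "0 < x" using T by auto
      show "real (card {y. (x, y) \<in> B}) \<le> (2 * real_of_int T ^ 3 / 3) * (1 / (real_of_int x)\<^sup>2) + 1"
      proof (rule card_int_le_diameter)
        fix y z assume "y \<in> {y. (x, y) \<in> B}" "z \<in> {y. (x, y) \<in> B}"
        then have yz: "(x, y) \<in> F" "(x, z) \<in> F" by (auto simp: B_def)
        have "3 * x\<^sup>2 * \<bar>y - z\<bar> \<le> 2 * T ^ 3"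
          using cube_diff_ge[of x y z] fibre[OF yz] pos[OF yz(1)] pos[OF yz(2)] by simp
        then have "real_of_int (3 * x\<^sup>2 * \<bar>y - z\<bar>) \<le> real_of_int (2 * T ^ 3)"
          by (simp only: of_int_le_iff)
        then show "real_of_int \<bar>y - z\<bar> \<le> (2 * real_of_int T ^ 3 / 3) * (1 / (real_of_int x)\<^sup>2)"
          using x by (simp add: field_simps)
      qed (use T in simp)
    qed (use finite in auto)
    also have "\<dots> = (2 * real_of_int T ^ 3 / 3) * (\<Sum>x\<in>{T<..T\<^sup>2}. 1 / (real_of_int x)\<^sup>2) + of_int (T\<^sup>2 - T)"
      using TT by (simp add: sum.distrib sum_distrib_left)
    also have "\<dots> \<le> (2 * real_of_int T ^ 3 / 3) * (1 / T) + of_int (T\<^sup>2)"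
      using T sum_inverse_squares_le[OF T TT]
      by (intro add_mono mult_left_mono) (auto intro: order_trans)
    also have "\<dots> = (2 / 3) * (real_of_int T)\<^sup>2 + (real_of_int T)\<^sup>2"
      using T by (simp add: power2_eq_square power3_eq_cube)
    also have "\<dots> \<le> 2 * (real_of_int T)\<^sup>2" by simp
    finally show ?thesis .
  qed

  have C: "real (card C) \<le> 3 * (real_of_int T)\<^sup>2"
  proof -
    \<comment> \<open>Fibring over the gap d = y - x instead of x leaves only T + 1 fibres. On each,
      x > T^2 makes x^2 + (x + d)^2 grow by at least 4T^2 per unit step.\<close>
    define C' where "C' = (\<lambda>(x, y). (y - x, x)) ` C"
    have C': "(x, x + d) \<in> C" if "(d, x) \<in> C'" for d x
    proof -
      obtain y where "(x, y) \<in> C" "d = y - x" using \<open>(d, x) \<in> C'\<close> by (auto simp: C'_def)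
      then show ?thesis by simp
    qed
    have "card C' = card C" unfolding C'_def by (rule card_image) (auto simp: inj_on_def)
    moreover have "real (card C') \<le> (\<Sum>d\<in>{0..T}. real_of_int T / 2 + 1)"
    proof (rule card_le_sum_fibres)
      show "fst ` C' \<subseteq> {0..T}" using pos by (force simp: C'_def C_def)
      fix d assume d: "d \<in> {0..T}"
      show "real (card {x. (d, x) \<in> C'}) \<le> real_of_int T / 2 + 1"
      proof (rule card_int_le_diameter)
        fix x z assume "x \<in> {x. (d, x) \<in> C'}" "z \<in> {x. (d, x) \<in> C'}"
        then have "(z, z + d) \<in> C" "(x, x + d) \<in> C" using C' by auto
        then have xz: "(z, z + d) \<in> F" "(x, x + d) \<in> F" "T\<^sup>2 < x" "T\<^sup>2 < z"
          by (auto simp: C_def)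
        have "4 * T\<^sup>2 * \<bar>x - z\<bar> \<le> \<bar>2 * (x + z + d)\<bar> * \<bar>x - z\<bar>"
          using xz d by (intro mult_right_mono) auto
        also have "\<dots> = \<bar>2 * (x + z + d) * (x - z)\<bar>" by (simp only: abs_mult)
        also have "2 * (x + z + d) * (x - z) = (x\<^sup>2 + (x + d)\<^sup>2) - (z\<^sup>2 + (z + d)\<^sup>2)"
          by (simp add: power2_eq_square algebra_simps)
        also have "\<bar>\<dots>\<bar> \<le> 2 * T ^ 3" using sq[OF xz(1,2)] .
        finally have "(2 * T\<^sup>2) * (2 * \<bar>x - z\<bar>) \<le> (2 * T\<^sup>2) * T"
          by (simp add: power2_eq_square power3_eq_cube algebra_simps)
        then have "2 * \<bar>x - z\<bar> \<le> T" using T by (simp add: mult_le_cancel_left)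
        then have "real_of_int (2 * \<bar>x - z\<bar>) \<le> real_of_int T" by (simp only: of_int_le_iff)
        then show "real_of_int \<bar>x - z\<bar> \<le> real_of_int T / 2" by simp
      qed (use T in simp)
    qed (use finite in \<open>auto simp: C'_def\<close>)
    ultimately have "real (card C) \<le> (\<Sum>d\<in>{0..T}. real_of_int T / 2 + 1)" by simp
    also have "\<dots> = (real_of_int T + 1) * (real_of_int T / 2 + 1)" using T by simp
    also have "\<dots> = (real_of_int T)\<^sup>2 / 2 + 3 / 2 * real_of_int T + 1"
      by (simp add: power2_eq_square field_simps)
    also have "\<dots> \<le> 3 * (real_of_int T)\<^sup>2" using TTr by linarith
    finally show ?thesis .
  qed

  have D: "real (card D) \<le> 12 * (real_of_int T)\<^sup>2"
  proof -
    \<comment> \<open>Distinct y, y' over the same x would have cubes at least 3T^4 apart, more than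
      the allowed 2T^3.\<close>
    have "inj_on fst D"
    proof (rule inj_onI, clarify)
      fix x y x' y' assume p: "(x, y) \<in> D" "(x', y') \<in> D" and "fst (x, y) = fst (x', y')"
      then have F: "(x, y) \<in> F" "(x, y') \<in> F" and y: "T\<^sup>2 \<le> y" "T\<^sup>2 \<le> y'" and [simp]: "x' = x"
        using T by (auto simp: D_def)
      have "3 * (T\<^sup>2)\<^sup>2 * \<bar>y - y'\<bar> \<le> 2 * T ^ 3"
        using cube_diff_ge[of "T\<^sup>2" y y'] y fibre[OF F] by simp
      also have "\<dots> < 3 * (T\<^sup>2)\<^sup>2" using T
        using mult_mono[of 1 T "T ^ 3" "T ^ 3"] zero_less_power[of T 3]
        by (simp add: power2_eq_square power3_eq_cube mult.assoc)
      finally have "\<bar>y - y'\<bar> < 1" using T by (simp add: mult_less_cancel_left1)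
      then show "x = x' \<and> y = y'" by simp
    qed
    then have "card D = card (fst ` D)" by (simp add: card_image)
    \<comment> \<open>The set of first coordinates has diameter at most 11 T^2 by
      \<open>first_increment_le\<close>, and T >= 1 absorbs the extra 1 into 12 T^2.\<close>
    also have "real \<dots> \<le> 11 * (real_of_int T)\<^sup>2 + 1"
    proof (rule card_int_le_diameter)
      fix x' x assume "x' \<in> fst ` D" "x \<in> fst ` D"
      then obtain y y' where p: "(x, y) \<in> F" "(x', y') \<in> F"
        and "T\<^sup>2 < x" "x + T < y" "T\<^sup>2 < x'" "x' + T < y'" by (auto simp: D_def)
      then have "\<bar>x' - x\<bar> \<le> 11 * T\<^sup>2"
        using T TT sq[OF p] cube[OF p] by (intro first_increment_le[of T x y x' y']) auto
      then have "real_of_int \<bar>x' - x\<bar> \<le> real_of_int (11 * T\<^sup>2)" by (simp only: of_int_le_iff)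
      then show "real_of_int \<bar>x' - x\<bar> \<le> 11 * (real_of_int T)\<^sup>2" by simp
    qed simp
    finally show ?thesis using TTr by simp
  qed

  have "F = A \<union> B \<union> C \<union> D"
    unfolding A_def B_def C_def D_def by (auto simp: not_le not_less)
  then have "card F \<le> card A + card B + card C + card D"
    using card_Un_le[of "A \<union> B \<union> C" D] card_Un_le[of "A \<union> B" C] card_Un_le[of A B] by simp
  then have "real (card F) \<le> real (card A) + real (card B) + real (card C) + real (card D)"
    by linarith
  then show ?thesis using A B C D by linarith
qed

text \<open>Both windows are symmetric in the two coordinates, so swapping reduces the pairs with y
  <= x to the ordered case and doubles 20 to 40.\<close>

lemma card_pairs_le:
  fixes F :: "(int \<times> int) set" and T :: int
  assumes fin: "finite F" and T: "1 \<le> T"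
    and pos: "\<And>x y. (x, y) \<in> F \<Longrightarrow> 1 \<le> x \<and> 1 \<le> y"
    and sq: "\<And>x y x' y'. (x, y) \<in> F \<Longrightarrow> (x', y') \<in> F \<Longrightarrow>
      \<bar>(x'\<^sup>2 + y'\<^sup>2) - (x\<^sup>2 + y\<^sup>2)\<bar> \<le> 2 * T ^ 3"
    and cube: "\<And>x y x' y'. (x, y) \<in> F \<Longrightarrow> (x', y') \<in> F \<Longrightarrow>
      \<bar>(x' ^ 3 + y' ^ 3) - (x ^ 3 + y ^ 3)\<bar> \<le> 2 * T ^ 3"
  shows "real (card F) \<le> 40 * (real_of_int T)\<^sup>2"
proof -
  define A where "A = {p \<in> F. fst p \<le> snd p}"
  define B where "B = {p \<in> F. snd p \<le> fst p}"
  have "real (card A) \<le> 20 * (real_of_int T)\<^sup>2"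
    by (rule card_ordered_pairs_le[OF _ T]) (use fin pos sq cube in \<open>auto simp: A_def\<close>)
  moreover have "real (card (prod.swap ` B)) \<le> 20 * (real_of_int T)\<^sup>2"
  proof (rule card_ordered_pairs_le[OF _ T])
    fix x y x' y' assume "(x, y) \<in> prod.swap ` B" "(x', y') \<in> prod.swap ` B"
    then have p: "(y, x) \<in> F" "(y', x') \<in> F" by (auto simp: B_def)
    show "\<bar>(x'\<^sup>2 + y'\<^sup>2) - (x\<^sup>2 + y\<^sup>2)\<bar> \<le> 2 * T ^ 3" using sq[OF p] by (simp add: add.commute)
    show "\<bar>(x' ^ 3 + y' ^ 3) - (x ^ 3 + y ^ 3)\<bar> \<le> 2 * T ^ 3" using cube[OF p] by (simp add: add.commute)
  qed (use fin pos in \<open>auto simp: B_def\<close>)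
  moreover have "card (prod.swap ` B) = card B" by (simp add: card_image)
  moreover have "card F \<le> card A + card B"
  proof -
    have "F = A \<union> B" by (auto simp: A_def B_def)
    then show ?thesis using card_Un_le[of A B] by simp
  qed
  ultimately show ?thesis by linarith
qed

section \<open>Summation of the decay over dyadic shells\<close>

text \<open>At most A 4^k points lie in the shell w ~ 8^k, each of weight about 8^(-\<beta> k). The
  ratio 4 * 8^(-\<beta>) is below 1 exactly when \<beta> > 2/3. The constant is chosen before
  \<open>I\<close> and \<open>w\<close>, which later makes it uniform in N and q.\<close>

lemma dyadic_weight_sum_bounded:
  fixes \<beta> A :: real
  assumes "\<beta> > 2 / 3" "A \<ge> 0"
  shows "\<exists>C. \<forall>(I :: 'i set) w. finite I \<longrightarrow> (\<forall>i\<in>I. w i \<ge> 0)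
      \<longrightarrow> (\<forall>k. real (card {i\<in>I. w i \<le> 8 ^ k}) \<le> A * 4 ^ k)
      \<longrightarrow> (\<Sum>i\<in>I. (1 + w i) powr (- \<beta>)) \<le> C"
proof -
  define r where "r = (8 :: real) powr (- \<beta>)"
  have r0: "0 < r" by (simp add: r_def)
  have "r < 8 powr (- (2 / 3))" unfolding r_def using assms by (intro powr_less_mono) auto
  also have "(8 :: real) powr (- (2 / 3)) = (2 powr 3) powr (- (2 / 3))" by simp
  also have "\<dots> = 1 / 4" by (subst powr_powr) (simp add: powr_minus powr_numeral)
  finally have r: "0 \<le> 4 * r" "4 * r < 1" using r0 by auto
  \<comment> \<open>The factor 1/r appears because a point of shell k is only known to satisfy w >
    8^(k - 1).\<close>
  define f where "f k = A / r * (4 * r) ^ k" for k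
  have f: "summable f" "\<And>k. 0 \<le> f k"
  proof -
    show "summable f" unfolding f_def using r by (intro summable_mult summable_geometric) simp
    show "0 \<le> f k" for k using r r0 assms by (simp add: f_def)
  qed
  show ?thesis
  proof (intro exI[of _ "suminf f"] allI impI)
    fix I :: "'i set" and w :: "'i \<Rightarrow> real"
    assume I: "finite I" "\<forall>i\<in>I. w i \<ge> 0"
      and card: "\<forall>k. real (card {i\<in>I. w i \<le> 8 ^ k}) \<le> A * 4 ^ k"
    define \<kappa> where "\<kappa> i = (LEAST k. w i \<le> 8 ^ k)" for i
    have ex: "\<exists>k. w i \<le> 8 ^ k" for i
      using real_arch_pow[of 8 "w i"] by (auto intro: less_imp_le)
    have \<kappa>: "w i \<le> 8 ^ \<kappa> i" for i unfolding \<kappa>_def using ex by (rule LeastI_ex)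
    have weight: "(1 + w i) powr (- \<beta>) \<le> r ^ \<kappa> i / r" if "i \<in> I" for i
    proof -
      \<comment> \<open>The real exponent lets the innermost shell fit the same formula: there the
        left side is 1/8, which is below 1 + w.\<close>
      have "8 powr (real (\<kappa> i) - 1) \<le> 1 + w i"
      proof (cases "\<kappa> i")
        case (Suc k)
        then have "\<not> w i \<le> 8 ^ k"
          using not_less_Least[of k "\<lambda>k. w i \<le> 8 ^ k"] by (simp add: \<kappa>_def)
        then show ?thesis using Suc by (simp add: powr_realpow)
      next
        case 0
        have "(8 :: real) powr (-1) \<le> 1" by simp
        then show ?thesis using 0 I that by (smt (verit) of_nat_0)
      qed
      then have "(1 + w i) powr (- \<beta>) \<le> (8 powr (real (\<kappa> i) - 1)) powr (- \<beta>)"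
        using assms by (intro powr_mono2') auto
      also have "\<dots> = 8 powr (- \<beta> * real (\<kappa> i) - - \<beta>)"
        by (simp add: powr_powr algebra_simps)
      also have "\<dots> = 8 powr (- \<beta> * real (\<kappa> i)) / r"
        by (simp only: powr_diff r_def)
      also have "8 powr (- \<beta> * real (\<kappa> i)) = r ^ \<kappa> i"
        by (simp add: r_def powr_power mult.commute)
      finally show ?thesis .
    qed
    have "(\<Sum>i\<in>I. (1 + w i) powr (- \<beta>)) \<le> (\<Sum>i\<in>I. r ^ \<kappa> i / r)"
      using weight by (rule sum_mono)
    also have "\<dots> = (\<Sum>k\<in>\<kappa> ` I. \<Sum>i\<in>{i\<in>I. \<kappa> i = k}. r ^ \<kappa> i / r)"
      by (rule sum.image_gen) fact
    also have "\<dots> \<le> (\<Sum>k\<in>\<kappa> ` I. f k)"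
    proof (rule sum_mono)
      fix k
      have "(\<Sum>i\<in>{i\<in>I. \<kappa> i = k}. r ^ \<kappa> i / r) = real (card {i\<in>I. \<kappa> i = k}) * (r ^ k / r)"
        by simp
      also have "\<dots> \<le> real (card {i\<in>I. w i \<le> 8 ^ k}) * (r ^ k / r)"
        using I r0 \<kappa> by (intro mult_right_mono) (auto intro!: card_mono)
      also have "\<dots> \<le> A * 4 ^ k * (r ^ k / r)"
        using card r0 by (intro mult_right_mono) auto
      also have "\<dots> = f k" by (simp add: f_def power_mult_distrib)
      finally show "(\<Sum>i\<in>{i\<in>I. \<kappa> i = k}. r ^ \<kappa> i / r) \<le> f k" .
    qed
    also have "\<dots> \<le> suminf f" using f I by (intro sum_le_suminf) auto
    finally show "(\<Sum>i\<in>I. (1 + w i) powr (- \<beta>)) \<le> suminf f" .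
  qed
qed

section \<open>Characters, Schur's test and the passage to Fourier coefficients\<close>

lemma e_add: "e (s + t) = e s * e t"
  by (simp add: e_def distrib_left exp_add)

lemma e_mult_cnj: "e s * cnj (e t) = e (s - t)"
proof -
  have "e s * cnj (e t) = exp (2 * of_real pi * \<i> * of_real s + cnj (2 * of_real pi * \<i> * of_real t))"
    by (simp only: e_def exp_cnj exp_add)
  also have "\<dots> = e (s - t)" unfolding e_def by (rule arg_cong[of _ _ exp]) (simp add: algebra_simps)
  finally show ?thesis .
qed

lemma norm_e [simp]: "cmod (e t) = 1"
  by (simp add: e_def)

lemma real_vec_diff: "real_vec (\<xi> - \<eta>) = real_vec \<xi> - real_vec \<eta>"
  by (simp add: real_vec_def vec_eq_iff)

lemma real_vec_add: "real_vec (\<xi> + \<eta>) = real_vec \<xi> + real_vec \<eta>"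
  by (simp add: real_vec_def vec_eq_iff)

text \<open>By b_i b_j <= (b_i^2 + b_j^2)/2 the form splits into two halves, which symmetry of the
  kernel makes equal; a bound on column sums then finishes.\<close>

lemma Schur_symmetric:
  fixes b :: "'i \<Rightarrow> real" and k :: "'i \<Rightarrow> 'i \<Rightarrow> real"
  assumes "\<And>i j. k i j \<ge> 0" "\<And>i j. k i j = k j i"
    and "\<And>j. j \<in> I \<Longrightarrow> (\<Sum>i\<in>I. k i j) \<le> M"
  shows "(\<Sum>i\<in>I. \<Sum>j\<in>I. b i * b j * k i j) \<le> M * (\<Sum>i\<in>I. (b i)\<^sup>2)"
proof -
  have "(\<Sum>i\<in>I. \<Sum>j\<in>I. b i * b j * k i j)
      \<le> (\<Sum>i\<in>I. \<Sum>j\<in>I. (b i)\<^sup>2 * k i j / 2 + (b j)\<^sup>2 * k i j / 2)"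
  proof (intro sum_mono)
    fix i j
    have "b i * b j \<le> ((b i)\<^sup>2 + (b j)\<^sup>2) / 2"
      using sum_squares_bound[of "b i" "b j"] by simp
    from mult_right_mono[OF this assms(1)[of i j]]
    show "b i * b j * k i j \<le> (b i)\<^sup>2 * k i j / 2 + (b j)\<^sup>2 * k i j / 2"
      by (simp add: algebra_simps add_divide_distrib)
  qed
  also have "\<dots> = (\<Sum>j\<in>I. \<Sum>i\<in>I. (b j)\<^sup>2 * k i j)"
  proof -
    have "(\<Sum>i\<in>I. \<Sum>j\<in>I. (b i)\<^sup>2 * k i j / 2) = (\<Sum>j\<in>I. \<Sum>i\<in>I. (b j)\<^sup>2 * k i j / 2)"
      by (intro sum.cong refl) (metis assms(2))
    moreover have "(\<Sum>i\<in>I. \<Sum>j\<in>I. (b j)\<^sup>2 * k i j / 2) = (\<Sum>j\<in>I. \<Sum>i\<in>I. (b j)\<^sup>2 * k i j / 2)"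
      by (rule sum.swap)
    ultimately have "(\<Sum>i\<in>I. \<Sum>j\<in>I. (b i)\<^sup>2 * k i j / 2 + (b j)\<^sup>2 * k i j / 2)
        = (\<Sum>j\<in>I. \<Sum>i\<in>I. (b j)\<^sup>2 * k i j / 2) + (\<Sum>j\<in>I. \<Sum>i\<in>I. (b j)\<^sup>2 * k i j / 2)"
      by (simp only: sum.distrib)
    also have "\<dots> = (\<Sum>j\<in>I. \<Sum>i\<in>I. (b j)\<^sup>2 * k i j / 2 + (b j)\<^sup>2 * k i j / 2)"
      by (simp only: sum.distrib)
    finally show ?thesis by (simp only: field_sum_of_halves)
  qed
  also have "\<dots> = (\<Sum>j\<in>I. (b j)\<^sup>2 * (\<Sum>i\<in>I. k i j))" by (simp add: sum_distrib_left)
  also have "\<dots> \<le> (\<Sum>j\<in>I. (b j)\<^sup>2 * M)"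
    using assms(3) by (intro sum_mono mult_left_mono) auto
  finally show ?thesis by (simp add: sum_distrib_left mult.commute)
qed

lemma integrable_e:
  assumes "torus3_measure \<sigma>"
  shows "integrable \<sigma> (\<lambda>x. e (v \<bullet> x))"
proof -
  interpret finite_measure \<sigma> using assms by (simp add: torus3_measure_def)
  have "(\<lambda>x. e (v \<bullet> x)) \<in> borel_measurable borel"
    unfolding e_def by (intro borel_measurable_continuous_onI continuous_intros)
  then have "(\<lambda>x. e (v \<bullet> x)) \<in> borel_measurable (restrict_space borel torus3)"
    by (rule measurable_restrict_space1)
  then have "(\<lambda>x. e (v \<bullet> x)) \<in> borel_measurable \<sigma>"
    using assms by (simp add: torus3_measure_def cong: measurable_cong_sets)
  then show ?thesis by (intro integrable_const_bound[of _ 1]) auto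
qed

text \<open>Expanding S times its conjugate produces the characters e(-(\<Phi>_j - \<Phi>_i).x), in
  the sign convention of \<open>fourier_coeff\<close>; the triangle inequality then discards all
  phases.\<close>

lemma integral_exponential_sum_square_le:
  fixes b :: "'i \<Rightarrow> complex" and \<Phi> :: "'i \<Rightarrow> int ^ 3"
  assumes \<sigma>: "torus3_measure \<sigma>"
  shows "(\<integral>x. (cmod (\<Sum>i\<in>I. b i * e (real_vec (\<Phi> i) \<bullet> x)))\<^sup>2 \<partial>\<sigma>)
    \<le> (\<Sum>i\<in>I. \<Sum>j\<in>I. cmod (b i) * cmod (b j) * cmod (fourier_coeff \<sigma> (\<Phi> j - \<Phi> i)))"
proof -
  define c where "c i j = b i * cnj (b j)" for i j
  have expand: "complex_of_real ((cmod (\<Sum>i\<in>I. b i * e (real_vec (\<Phi> i) \<bullet> x)))\<^sup>2)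
      = (\<Sum>i\<in>I. \<Sum>j\<in>I. c i j * e (- (real_vec (\<Phi> j - \<Phi> i) \<bullet> x)))" for x
  proof -
    have "b i * e (real_vec (\<Phi> i) \<bullet> x) * cnj (b j * e (real_vec (\<Phi> j) \<bullet> x))
        = c i j * e (- (real_vec (\<Phi> j - \<Phi> i) \<bullet> x))" for i j
      using e_mult_cnj[of "real_vec (\<Phi> i) \<bullet> x" "real_vec (\<Phi> j) \<bullet> x"]
      by (simp add: c_def real_vec_diff inner_diff_left mult_ac)
    then show ?thesis
      unfolding complex_norm_square cnj_sum sum_product by simp
  qed
  have int: "integrable \<sigma> (\<lambda>x. e (- (real_vec \<xi> \<bullet> x)))" for \<xi>
    using integrable_e[OF \<sigma>, of "- real_vec \<xi>"] by simp
  have "complex_of_real (\<integral>x. (cmod (\<Sum>i\<in>I. b i * e (real_vec (\<Phi> i) \<bullet> x)))\<^sup>2 \<partial>\<sigma>)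
      = (\<integral>x. (\<Sum>i\<in>I. \<Sum>j\<in>I. c i j * e (- (real_vec (\<Phi> j - \<Phi> i) \<bullet> x))) \<partial>\<sigma>)"
    unfolding integral_complex_of_real[symmetric] expand ..
  also have "\<dots> = (\<Sum>i\<in>I. \<Sum>j\<in>I. c i j * fourier_coeff \<sigma> (\<Phi> j - \<Phi> i))"
    using int by (simp add: fourier_coeff_def)
  finally have eq: "complex_of_real (\<integral>x. (cmod (\<Sum>i\<in>I. b i * e (real_vec (\<Phi> i) \<bullet> x)))\<^sup>2 \<partial>\<sigma>)
      = (\<Sum>i\<in>I. \<Sum>j\<in>I. c i j * fourier_coeff \<sigma> (\<Phi> j - \<Phi> i))" .
  have "(\<integral>x. (cmod (\<Sum>i\<in>I. b i * e (real_vec (\<Phi> i) \<bullet> x)))\<^sup>2 \<partial>\<sigma>)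
      \<le> cmod (\<Sum>i\<in>I. \<Sum>j\<in>I. c i j * fourier_coeff \<sigma> (\<Phi> j - \<Phi> i))"
    unfolding eq[symmetric] norm_of_real by (rule abs_ge_self)
  also have "\<dots> \<le> (\<Sum>i\<in>I. \<Sum>j\<in>I. cmod (c i j * fourier_coeff \<sigma> (\<Phi> j - \<Phi> i)))"
    by (rule order_trans[OF norm_sum]) (intro sum_mono norm_sum)
  finally show ?thesis by (simp add: c_def norm_mult)
qed

section \<open>Frequencies on the moment curve\<close>

definition moment_phase :: "nat \<Rightarrow> int ^ 3"
  where "moment_phase n = (\<chi> i. if i = 1 then int n else if i = 2 then int n ^ 2 else int n ^ 3)"

text \<open>These are the frequencies of the square of the exponential sum, indexed by ordered pairs
  and hence with multiplicity.\<close>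

definition pair_phase :: "nat \<times> nat \<Rightarrow> int ^ 3"
  where "pair_phase p = moment_phase (fst p) + moment_phase (snd p)"

lemma moment_phase_inner:
  "real_vec (moment_phase n) \<bullet> x = x $ 1 * real n + x $ 2 * real n ^ 2 + x $ 3 * real n ^ 3"
  by (simp add: inner_vec_def sum_3 real_vec_def moment_phase_def)

text \<open>With T = 2^k, the radius 8^k is T^3 and the count 40 T^2 is 40 * 4^k, just the growth
  that the dyadic summation accepts. The second and third coordinates supply the windows for squares
  and cubes.\<close>

lemma pair_phase_weight_sum_bounded:
  fixes \<beta> :: real
  assumes "\<beta> > 2 / 3"
  shows "\<exists>C. \<forall>N. \<forall>q.
    (\<Sum>p\<in>{1..N} \<times> {1..N}. (1 + norm (real_vec (pair_phase p - pair_phase q))) powr (- \<beta>)) \<le> C"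
proof -
  obtain C where C: "\<forall>(I :: (nat \<times> nat) set) w. finite I \<longrightarrow> (\<forall>i\<in>I. w i \<ge> 0)
      \<longrightarrow> (\<forall>k. real (card {i\<in>I. w i \<le> 8 ^ k}) \<le> 40 * 4 ^ k)
      \<longrightarrow> (\<Sum>i\<in>I. (1 + w i) powr (- \<beta>)) \<le> C"
    using dyadic_weight_sum_bounded[OF assms zero_le_numeral] by blast
  show ?thesis
  proof (intro exI[of _ C] allI C[rule_format])
    fix N :: nat and q :: "nat \<times> nat" and k :: nat
    let ?w = "\<lambda>p. norm (real_vec (pair_phase p - pair_phase q))"
    let ?S = "{p \<in> {1..N} \<times> {1..N}. ?w p \<le> 8 ^ k}"
    let ?h = "map_prod int int"
    have coord: "\<bar>(pair_phase p - pair_phase q) $ i\<bar> \<le> 8 ^ k" if "?w p \<le> 8 ^ k" for p i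
    proof -
      have "\<bar>real_vec (pair_phase p - pair_phase q) $ i\<bar> \<le> 8 ^ k"
        using that component_le_norm_cart order_trans by blast
      then have "real_of_int \<bar>(pair_phase p - pair_phase q) $ i\<bar> \<le> real_of_int (8 ^ k)"
        by (simp add: real_vec_def)
      then show ?thesis by (simp only: of_int_le_iff)
    qed
    have cube: "((2 :: int) ^ k) ^ 3 = 8 ^ k"
      unfolding power_mult[symmetric] mult.commute[of k] by (simp add: power_mult)
    \<comment> \<open>Two points within 8^k of the same q differ by at most 2 * 8^k = 2T^3 in each
      coordinate.\<close>
    have close: "\<bar>pair_phase p' $ i - pair_phase p $ i\<bar> \<le> 2 * (2 ^ k) ^ 3"
      if "p \<in> ?S" "p' \<in> ?S" for p p' i
      using coord[of p i] coord[of p' i] that unfolding cube by auto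
    have "card ?S = card (?h ` ?S)"
      by (rule card_image[symmetric]) (auto simp: inj_on_def)
    also have "real \<dots> \<le> 40 * (real_of_int (2 ^ k))\<^sup>2"
    proof (rule card_pairs_le)
      fix x y x' y' assume "(x, y) \<in> ?h ` ?S" "(x', y') \<in> ?h ` ?S"
      then obtain m n m' n' where *: "(m, n) \<in> ?S" "(m', n') \<in> ?S"
        "x = int m" "y = int n" "x' = int m'" "y' = int n'" by auto
      show "\<bar>(x'\<^sup>2 + y'\<^sup>2) - (x\<^sup>2 + y\<^sup>2)\<bar> \<le> 2 * (2 ^ k) ^ 3"
        using close[OF *(1,2), of 2] *(3-) by (simp add: pair_phase_def moment_phase_def)
      show "\<bar>(x' ^ 3 + y' ^ 3) - (x ^ 3 + y ^ 3)\<bar> \<le> 2 * (2 ^ k) ^ 3"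
        using close[OF *(1,2), of 3] *(3-) by (simp add: pair_phase_def moment_phase_def)
    qed auto
    also have "(real_of_int (2 ^ k))\<^sup>2 = 4 ^ k"
      unfolding of_int_power power_mult[symmetric] mult.commute[of k] by (simp add: power_mult)
    finally show "real (card ?S) \<le> 40 * 4 ^ k" .
  qed auto
qed

section \<open>The fourth moment estimate\<close>

theorem theorem12p1:
  fixes \<sigma> :: "(real ^ 3) measure" and \<beta> :: real
  assumes "torus3_measure \<sigma>"
    and "\<beta> > 2 / 3"
    and "\<exists>K. \<forall>\<xi> :: int ^ 3. cmod (fourier_coeff \<sigma> \<xi>) \<le> K * (1 + norm (real_vec \<xi>)) powr (- \<beta>)"
  shows "\<exists>C. \<forall>N \<ge> 1. \<forall>a :: nat \<Rightarrow> complex.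
    (\<integral>x. (cmod (\<Sum>n=1..N. a n * e (x $ 1 * real n + x $ 2 * real n ^ 2 + x $ 3 * real n ^ 3))) ^ 4 \<partial>\<sigma>)
      \<le> C * l2_norm N a ^ 4"
proof -
  obtain K where K: "\<And>\<xi>. cmod (fourier_coeff \<sigma> \<xi>) \<le> K * (1 + norm (real_vec \<xi>)) powr (- \<beta>)"
    using assms(3) by blast
  \<comment> \<open>At frequency 0 the weight is 1, so \<open>K\<close> dominates a norm. Its sign
    is needed for a nonnegative Schur kernel.\<close>
  have "0 \<le> K"
    using order_trans[OF norm_ge_zero K[of 0]] by (simp add: real_vec_def zero_vec_def[symmetric])
  obtain C where C: "\<And>N q. (\<Sum>p\<in>{1..N} \<times> {1..N}.
      (1 + norm (real_vec (pair_phase p - pair_phase q))) powr (- \<beta>)) \<le> C"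
    using pair_phase_weight_sum_bounded[OF assms(2)] by blast
  show ?thesis
  proof (intro exI[of _ "K * C"] allI impI)
    fix N :: nat and a :: "nat \<Rightarrow> complex"
    let ?I = "{1..N} \<times> {1..N}"
    define b where "b p = a (fst p) * a (snd p)" for p
    \<comment> \<open>A symmetric nonnegative majorant of the Fourier coefficients, in the form that
      Schur's test takes.\<close>
    define k where "k p q = K * (1 + norm (real_vec (pair_phase q - pair_phase p))) powr (- \<beta>)" for p q
    have "(cmod (\<Sum>n=1..N. a n * e (x $ 1 * real n + x $ 2 * real n ^ 2 + x $ 3 * real n ^ 3))) ^ 4
        = (cmod (\<Sum>p\<in>?I. b p * e (real_vec (pair_phase p) \<bullet> x)))\<^sup>2" for x
    proof -
      let ?S = "\<Sum>n=1..N. a n * e (real_vec (moment_phase n) \<bullet> x)"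
      have eq: "?S * ?S = (\<Sum>p\<in>?I. b p * e (real_vec (pair_phase p) \<bullet> x))"
        unfolding sum_product sum.cartesian_product b_def pair_phase_def
        by (intro sum.cong) (auto simp: real_vec_add inner_add_left e_add)
      have "(cmod ?S) ^ 4 = (cmod ?S * cmod ?S)\<^sup>2"
        by (simp only: power4_eq_xxxx power2_eq_square mult.assoc)
      also have "\<dots> = (cmod (\<Sum>p\<in>?I. b p * e (real_vec (pair_phase p) \<bullet> x)))\<^sup>2"
        by (simp only: eq flip: norm_mult)
      finally show ?thesis by (simp only: moment_phase_inner)
    qed
    then have "(\<integral>x. (cmod (\<Sum>n=1..N. a n * e (x $ 1 * real n + x $ 2 * real n ^ 2 + x $ 3 * real n ^ 3))) ^ 4 \<partial>\<sigma>)
        = (\<integral>x. (cmod (\<Sum>p\<in>?I. b p * e (real_vec (pair_phase p) \<bullet> x)))\<^sup>2 \<partial>\<sigma>)" by simp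
    also have "\<dots> \<le> (\<Sum>p\<in>?I. \<Sum>q\<in>?I. cmod (b p) * cmod (b q) *
        cmod (fourier_coeff \<sigma> (pair_phase q - pair_phase p)))"
      using assms(1) by (rule integral_exponential_sum_square_le)
    also have "\<dots> \<le> (\<Sum>p\<in>?I. \<Sum>q\<in>?I. cmod (b p) * cmod (b q) * k p q)"
      unfolding k_def using K by (intro sum_mono mult_left_mono) auto
    also have "\<dots> \<le> K * C * (\<Sum>p\<in>?I. (cmod (b p))\<^sup>2)"
    proof (rule Schur_symmetric)
      show sym: "k p q = k q p" for p q by (simp add: k_def real_vec_diff norm_minus_commute)
      show "0 \<le> k p q" for p q using \<open>0 \<le> K\<close> by (simp add: k_def)
      \<comment> \<open>Symmetry turns \<open>k p q\<close> into \<open>k q p\<close>, whose phase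
        difference has the orientation of the weight sum bounded by \<open>C\<close>.\<close>
      show "(\<Sum>p\<in>?I. k p q) \<le> K * C" for q
        unfolding sym[of _ q] unfolding k_def sum_distrib_left[symmetric]
        using C \<open>0 \<le> K\<close> by (rule mult_left_mono)
    qed
    \<comment> \<open>The coefficients are products, so their squared norm over pairs factors into
      the square of the sum of |a_n|^2.\<close>
    also have "(\<Sum>p\<in>?I. (cmod (b p))\<^sup>2) = (\<Sum>n=1..N. (cmod (a n))\<^sup>2)\<^sup>2"
      unfolding power2_eq_square[of "sum _ _"] sum_product sum.cartesian_product
      by (intro sum.cong) (auto simp: b_def norm_mult power_mult_distrib)
    also have "\<dots> = l2_norm N a ^ 4"
    proof -
      have "l2_norm N a ^ 4 = ((l2_norm N a)\<^sup>2)\<^sup>2" by (simp flip: power_mult)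
      then show ?thesis by (simp add: l2_norm_def sum_nonneg)
    qed
    finally show "(\<integral>x. (cmod (\<Sum>n=1..N. a n * e (x $ 1 * real n + x $ 2 * real n ^ 2 + x $ 3 * real n ^ 3))) ^ 4 \<partial>\<sigma>)
        \<le> K * C * l2_norm N a ^ 4" .
  qed
qed

end
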